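(* Let $p$ be a prime, $n=p^2$, and let $\Gamma=\Gamma(D_{2n})$ be the intersection graph of $D_{2n}$. Then the eccentric connectivity index of $\Gamma$ is $\xi^c(\Gamma)=7p^2+6p+4$.
   Context: $D_{2n}=\langle r,s : r^n=s^2=1,\ srs=r^{-1}\rangle$ is the dihedral group of order $2n$. The intersection graph $\Gamma(G)$ of a finite group $G$ has as vertices the proper non-trivial subgroups of $G$, two distinct vertices being adjacent iff their intersection is non-trivial. The eccentric connectivity index is $\xi^c(\Gamma)=\sum_{v\in V(\Gamma)}\deg(v)\operatorname{ecc}(v)$, where $\operatorname{ecc}(v)$ is the largest distance from $v$ to any other vertex. *)

theory Defs
  imports
    "HOL-Algebra.Coset"
    "HOL-Computational_Algebra.Primes"
    "Graph_Theory.Pair_Digraph"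
    "Graph_Theory.Shortest_Path"
begin

section \<open>Groups given by generators and relations\<close>

text \<open>
  A word over a set of generators is a list of signed letters: \<open>(x, True)\<close> stands for
  the generator \<open>x\<close> and \<open>(x, False)\<close> for its inverse.  A relation \<open>u = v\<close> is the
  pair \<open>(u, v)\<close>.  The presented group is the set of all words modulo the least congruence
  for concatenation that contains the relations and cancels adjacent inverse letters.
\<close>

type_synonym 'g word = "('g \<times> bool) list"

inductive pres_eq :: "('g word \<times> 'g word) set \<Rightarrow> 'g word \<Rightarrow> 'g word \<Rightarrow> bool"
  for R :: "('g word \<times> 'g word) set" where
  refl: "pres_eq R w w"
| sym: "pres_eq R v w \<Longrightarrow> pres_eq R w v"
| trans: "pres_eq R u v \<Longrightarrow> pres_eq R v w \<Longrightarrow> pres_eq R u w"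
| cancel: "pres_eq R (u @ [(x, b), (x, \<not> b)] @ v) (u @ v)"
| relation: "(a, b) \<in> R \<Longrightarrow> pres_eq R (u @ a @ v) (u @ b @ v)"

definition pres_rel :: "('g word \<times> 'g word) set \<Rightarrow> ('g word \<times> 'g word) set" where
  "pres_rel R = {(u, v). pres_eq R u v}"

definition presented_group :: "('g word \<times> 'g word) set \<Rightarrow> 'g word set monoid" where
  "presented_group R =
    \<lparr> carrier = UNIV // pres_rel R,
      monoid.mult = (\<lambda>A B. \<Union>a\<in>A. \<Union>b\<in>B. pres_rel R `` {a @ b}),
      one = pres_rel R `` {[]} \<rparr>"

lemma equiv_pres_rel: "equiv UNIV (pres_rel R)"
  unfolding equiv_def refl_on_def sym_def trans_def pres_rel_def
  using pres_eq.refl pres_eq.sym pres_eq.trans by fast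

lemma pres_eq_context:
  "pres_eq R u v \<Longrightarrow> pres_eq R (a @ u @ b) (a @ v @ b)"
proof (induction rule: pres_eq.induct)
  case (cancel u x c v)
  show ?case using pres_eq.cancel[of R "a @ u" x c "v @ b"] by simp
next
  case (relation l r u v)
  show ?case using pres_eq.relation[OF relation, of "a @ u" "v @ b"] by simp
next
  case refl
  show ?case by (rule pres_eq.refl)
next
  case sym
  show ?case by (rule pres_eq.sym[OF sym.IH])
next
  case trans
  show ?case by (rule pres_eq.trans[OF trans.IH])
qed

lemma pres_eq_append:
  "pres_eq R u u' \<Longrightarrow> pres_eq R v v' \<Longrightarrow> pres_eq R (u @ v) (u' @ v')"
  using pres_eq_context[of R u u' "[]" v] pres_eq_context[of R v v' u' "[]"]
  by (simp add: pres_eq.trans[of R "u @ v" "u' @ v" "u' @ v'"])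

lemma pres_class_eq: "pres_rel R `` {u} = pres_rel R `` {v} \<longleftrightarrow> pres_eq R u v"
  using eq_equiv_class_iff[OF equiv_pres_rel, of u v R] by (simp add: pres_rel_def)

lemma presented_group_mult:
  "pres_rel R `` {u} \<otimes>\<^bsub>presented_group R\<^esub> pres_rel R `` {v} = pres_rel R `` {u @ v}"
proof -
  have "congruent2 (pres_rel R) (pres_rel R) (\<lambda>a b. pres_rel R `` {a @ b})"
    by (rule congruent2I') (simp add: pres_class_eq, simp add: pres_rel_def pres_eq_append)
  from UN_equiv_class2[OF equiv_pres_rel equiv_pres_rel this]
  show ?thesis by (simp add: presented_group_def)
qed

definition inv_word :: "'g word \<Rightarrow> 'g word" where
  "inv_word w = rev (map (\<lambda>(x, b). (x, \<not> b)) w)"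

lemma pres_eq_inv_word: "pres_eq R (inv_word w @ w) []"
proof (induction w)
  case Nil
  show ?case by (simp add: inv_word_def pres_eq.refl)
next
  case (Cons l w)
  obtain x b where l: "l = (x, b)" by force
  have "inv_word (l # w) @ l # w = inv_word w @ [(x, \<not> b), (x, \<not> \<not> b)] @ w"
    by (simp add: inv_word_def l)
  with pres_eq.cancel[of R "inv_word w" x "\<not> b" w] Cons show ?case
    by (metis pres_eq.trans)
qed

lemma carrier_presented_group: "carrier (presented_group R) = range (\<lambda>w. pres_rel R `` {w})"
  by (auto simp: presented_group_def quotient_def)

lemma one_presented_group: "\<one>\<^bsub>presented_group R\<^esub> = pres_rel R `` {[]}"
  by (simp add: presented_group_def)

lemma group_presented_group: "group (presented_group R)"
proof (rule groupI)
  fix x assume "x \<in> carrier (presented_group R)"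
  then obtain w where w: "x = pres_rel R `` {w}" by (auto simp: carrier_presented_group)
  have "pres_rel R `` {inv_word w} \<otimes>\<^bsub>presented_group R\<^esub> x = \<one>\<^bsub>presented_group R\<^esub>"
    by (simp add: w presented_group_mult one_presented_group pres_class_eq pres_eq_inv_word)
  then show "\<exists>y\<in>carrier (presented_group R). y \<otimes>\<^bsub>presented_group R\<^esub> x = \<one>\<^bsub>presented_group R\<^esub>"
    by (auto simp: carrier_presented_group)
qed (auto simp: carrier_presented_group presented_group_mult one_presented_group)


section \<open>The dihedral group\<close>

datatype dihedral_gen = Rot | Flip

definition dihedral_relations :: "nat \<Rightarrow> (dihedral_gen word \<times> dihedral_gen word) set" where
  "dihedral_relations n =
    {(replicate n (Rot, True), []),
     ([(Flip, True), (Flip, True)], []),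
     ([(Flip, True), (Rot, True), (Flip, True)], [(Rot, False)])}"

text \<open>The parameter is \<open>n\<close>, so \<open>dihedral_group n\<close> is the group of order \<open>2 * n\<close>.\<close>

definition dihedral_group :: "nat \<Rightarrow> dihedral_gen word set monoid" where
  "dihedral_group n = presented_group (dihedral_relations n)"

lemma group_dihedral_group: "group (dihedral_group n)"
  by (simp add: dihedral_group_def group_presented_group)

subsection \<open>Normal forms and the order\<close>

text \<open>
  The pair \<open>(k, e)\<close> below represents the element \<open>r\<^sup>k s\<^sup>e\<close>;
  \<open>dih_letter n\<close> is left multiplication by a letter.
\<close>

fun dih_letter :: "nat \<Rightarrow> dihedral_gen \<times> bool \<Rightarrow> int \<times> bool \<Rightarrow> int \<times> bool" where
  "dih_letter n (Rot, True) (k, e) = ((k + 1) mod int n, e)"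
| "dih_letter n (Rot, False) (k, e) = ((k - 1) mod int n, e)"
| "dih_letter n (Flip, b) (k, e) = ((- k) mod int n, \<not> e)"

definition dih_eval :: "nat \<Rightarrow> dihedral_gen word \<Rightarrow> int \<times> bool \<Rightarrow> int \<times> bool" where
  "dih_eval n w = foldr (dih_letter n) w"

definition dih_canon :: "int \<times> bool \<Rightarrow> dihedral_gen word" where
  "dih_canon = (\<lambda>(k, e). replicate (nat k) (Rot, True) @ (if e then [(Flip, True)] else []))"

abbreviation dih_states :: "nat \<Rightarrow> (int \<times> bool) set" where
  "dih_states n \<equiv> {0..<int n} \<times> UNIV"

lemma dih_letter_states: "n > 0 \<Longrightarrow> x \<in> dih_states n \<Longrightarrow> dih_letter n l x \<in> dih_states n"
  by (cases "(n, l, x)" rule: dih_letter.cases) auto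

lemma dih_eval_states: "n > 0 \<Longrightarrow> x \<in> dih_states n \<Longrightarrow> dih_eval n w x \<in> dih_states n"
  unfolding dih_eval_def
proof (induction w)
  case (Cons l w)
  then show ?case using dih_letter_states by (simp only: foldr_Cons comp_apply)
qed simp

lemma dih_eval_append: "dih_eval n (u @ v) x = dih_eval n u (dih_eval n v x)"
  by (simp add: dih_eval_def)

lemma dih_eval_rot:
  "k \<in> {0..<int n} \<Longrightarrow> dih_eval n (replicate m (Rot, True)) (k, e) = ((k + int m) mod int n, e)"
  by (induction m) (simp_all add: dih_eval_def mod_simps ac_simps)

lemma dih_eval_respects:
  assumes "n > 0"
  shows "pres_eq (dihedral_relations n) u v \<Longrightarrow> x \<in> dih_states n \<Longrightarrow>
    dih_eval n u x = dih_eval n v x"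
proof (induction arbitrary: x rule: pres_eq.induct)
  case (sym v w)
  show ?case by (rule sym.IH[OF sym.prems, symmetric])
next
  case (trans u v w)
  show ?case by (rule HOL.trans[OF trans.IH(1)[OF trans.prems] trans.IH(2)[OF trans.prems]])
next
  case (cancel u g b v)
  obtain k e where ke: "dih_eval n v x = (k, e)" "k \<in> {0..<int n}"
    using dih_eval_states[OF assms cancel, of v] by force
  have "dih_eval n [(g, b), (g, \<not> b)] (k, e) = (k, e)"
    using ke(2) by (cases g; cases b) (simp_all add: dih_eval_def mod_simps)
  with ke show ?case by (simp only: dih_eval_append)
next
  case (relation a b u v)
  obtain k e where ke: "dih_eval n v x = (k, e)" "k \<in> {0..<int n}"
    using dih_eval_states[OF assms relation(2), of v] by force
  consider "a = replicate n (Rot, True)" "b = []" | "a = [(Flip, True), (Flip, True)]" "b = []"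
    | "a = [(Flip, True), (Rot, True), (Flip, True)]" "b = [(Rot, False)]"
    using relation(1) by (auto simp: dihedral_relations_def)
  then have "dih_eval n a (k, e) = dih_eval n b (k, e)"
  proof cases
    case 1
    then show ?thesis using dih_eval_rot[OF ke(2), of n e] ke(2) by (simp add: dih_eval_def)
  next
    case 2
    then show ?thesis using ke(2) by (simp add: dih_eval_def mod_simps)
  next
    case 3
    have "- ((1 - k) mod int n) mod int n = (k - 1) mod int n"
      by (simp add: mod_simps)
    then show ?thesis using 3 by (simp add: dih_eval_def mod_simps)
  qed
  with ke show ?case by (simp only: dih_eval_append)
qed (rule HOL.refl)

lemma dih_eval_canon: "x \<in> dih_states n \<Longrightarrow> dih_eval n (dih_canon x) (0, False) = x"
  using dih_eval_rot[of 0 n "nat (fst x)"]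
  by (cases x) (auto simp: dih_canon_def dih_eval_append, simp_all add: dih_eval_def)

lemma order_dihedral_group:
  assumes "n > 0"
  shows "order (dihedral_group n) = 2 * n"
proof -
  define R where "R = dihedral_relations n"
  let ?c = "\<lambda>w. pres_rel R `` {w}"
  note tr = pres_eq.trans[of R] and ctx = pres_eq_context[of R]
  have rn: "pres_eq R (replicate n (Rot, True)) []"
    using pres_eq.relation[of "replicate n (Rot, True)" "[]" R "[]" "[]"]
    by (simp add: R_def dihedral_relations_def)
  have ss: "pres_eq R [(Flip, True), (Flip, True)] []"
    using pres_eq.relation[of "[(Flip, True), (Flip, True)]" "[]" R "[]" "[]"]
    by (simp add: R_def dihedral_relations_def)
  have srs: "pres_eq R [(Flip, True), (Rot, True), (Flip, True)] [(Rot, False)]"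
    using pres_eq.relation[of "[(Flip, True), (Rot, True), (Flip, True)]" "[(Rot, False)]" R "[]" "[]"]
    by (simp add: R_def dihedral_relations_def)
  have Ri: "pres_eq R [(Rot, False)] (replicate (n - 1) (Rot, True))"
  proof -
    have n: "replicate n (Rot, True) = (Rot, True) # replicate (n - 1) (Rot, True)"
      using assms by (cases n) auto
    have "pres_eq R ((Rot, False) # replicate n (Rot, True)) [(Rot, False)]"
      using ctx[OF rn, of "[(Rot, False)]" "[]"] by simp
    moreover have "pres_eq R ((Rot, False) # replicate n (Rot, True)) (replicate (n - 1) (Rot, True))"
      using pres_eq.cancel[of R "[]" Rot False "replicate (n - 1) (Rot, True)"] by (simp add: n)
    ultimately show ?thesis by (blast intro: tr[OF pres_eq.sym])
  qed
  have Si: "pres_eq R [(Flip, False)] [(Flip, True)]"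
    using tr[OF pres_eq.sym[OF ctx[OF ss, of "[(Flip, False)]" "[]"]],
        of "[(Flip, True)]"]
      pres_eq.cancel[of R "[]" Flip False "[(Flip, True)]"]
    by simp
  \<comment> \<open>pulling a reflection through a rotation\<close>
  have sr: "pres_eq R [(Flip, True), (Rot, True)] [(Rot, False), (Flip, True)]"
    using tr[OF pres_eq.sym[OF ctx[OF ss, of "[(Flip, True), (Rot, True)]" "[]"]],
        of "[(Rot, False), (Flip, True)]"]
      ctx[OF srs, of "[]" "[(Flip, True)]"]
    by simp
  have srk: "pres_eq R ((Flip, True) # replicate m (Rot, True)) (replicate m (Rot, False) @ [(Flip, True)])" for m
  proof (induction m)
    case 0 show ?case by (simp add: pres_eq.refl)
  next
    case (Suc m)
    show ?case
      using tr[OF ctx[OF sr, of "[]" "replicate m (Rot, True)"],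
          of "replicate (Suc m) (Rot, False) @ [(Flip, True)]"]
        ctx[OF Suc, of "[(Rot, False)]" "[]"]
      by simp
  qed
  have rotmod: "pres_eq R (replicate m (Rot, True)) (replicate (m mod n) (Rot, True))" for m
  proof (induction m rule: less_induct)
    case (less m)
    show ?case
    proof (cases "m < n")
      case True then show ?thesis by (simp add: pres_eq.refl)
    next
      case False
      then have "replicate m (Rot, True) = replicate n (Rot, True) @ replicate (m - n) (Rot, True)"
        by (simp flip: replicate_add)
      then have "pres_eq R (replicate m (Rot, True)) (replicate (m - n) (Rot, True))"
        using ctx[OF rn, of "[]" "replicate (m - n) (Rot, True)"] by simp
      moreover have "m mod n = (m - n) mod n" using False by (simp add: le_mod_geq)
      moreover have "pres_eq R (replicate (m - n) (Rot, True)) (replicate ((m - n) mod n) (Rot, True))"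
        using False assms by (intro less) simp
      ultimately show ?thesis using tr by metis
    qed
  qed
  have Rik: "pres_eq R (replicate m (Rot, False)) (replicate (m * (n - 1)) (Rot, True))" for m
  proof (induction m)
    case 0 show ?case by (simp add: pres_eq.refl)
  next
    case (Suc m)
    show ?case using pres_eq_append[OF Ri Suc] by (simp add: replicate_add)
  qed
  have step: "pres_eq R (l # dih_canon x) (dih_canon (dih_letter n l x))" if x: "x \<in> dih_states n" for l x
  proof -
    define m where "m = nat (fst x)"
    define e where "e = snd x"
    have xm: "x = (int m, e)"
      using x by (auto simp: m_def e_def)
    let ?t = "if e then [(Flip, True)] else []"
    have n1: "int (n - 1) = int n - 1" using assms by (simp add: of_nat_diff)
    have "(- int m) mod int n = (- int m + int m * int n) mod int n"
      by (rule mod_mult_self1[symmetric])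
    also have "- int m + int m * int n = int (m * (n - 1))"
      unfolding of_nat_mult n1 by (simp add: right_diff_distrib)
    also have "\<dots> mod int n = int (m * (n - 1) mod n)"
      by (rule zmod_int[symmetric])
    finally have neg: "nat ((- int m) mod int n) = (m * (n - 1)) mod n"
      by simp
    have "(int m - 1) mod int n = (int m - 1 + int n) mod int n"
      by (rule mod_add_self2[symmetric])
    also have "int m - 1 + int n = int (m + (n - 1))"
      unfolding of_nat_add n1 by simp
    also have "\<dots> mod int n = int ((m + (n - 1)) mod n)"
      by (rule zmod_int[symmetric])
    finally have pred: "nat ((int m - 1) mod int n) = (m + (n - 1)) mod n"
      by simp
    have "(int m + 1) mod int n = int (Suc m mod n)"
      by (simp add: zmod_int add.commute)
    then have suc: "nat ((int m + 1) mod int n) = Suc m mod n"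
      by simp
    obtain g b where l: "l = (g, b)" by force
    consider "g = Rot" "b" | "g = Rot" "\<not> b" | "g = Flip" by (cases g) auto
    then show ?thesis
    proof cases
      case 1
      then show ?thesis using pres_eq_append[OF rotmod[of "Suc m"] pres_eq.refl[of R ?t]]
        by (simp add: l xm dih_canon_def suc)
    next
      case 2
      have "pres_eq R ([(Rot, False)] @ replicate m (Rot, True)) (replicate ((n - 1) + m) (Rot, True))"
        using pres_eq_append[OF Ri pres_eq.refl] by (simp add: replicate_add)
      then have "pres_eq R ([(Rot, False)] @ replicate m (Rot, True)) (replicate ((m + (n - 1)) mod n) (Rot, True))"
        using rotmod by (metis add.commute pres_eq.trans)
      from pres_eq_append[OF this pres_eq.refl[of R ?t]] show ?thesis
        using 2 by (simp add: l xm dih_canon_def pred)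
    next
      case 3
      have s: "pres_eq R [l] [(Flip, True)]"
        using 3 Si pres_eq.refl by (cases b) (auto simp: l)
      have "pres_eq R ((Flip, True) # replicate m (Rot, True))
        (replicate ((m * (n - 1)) mod n) (Rot, True) @ [(Flip, True)])"
        by (rule tr[OF srk pres_eq_append[OF tr[OF Rik rotmod] pres_eq.refl]])
      from tr[OF pres_eq_append[OF s pres_eq.refl[of R "replicate m (Rot, True)"]]] this
      have "pres_eq R (l # replicate m (Rot, True))
        (replicate ((m * (n - 1)) mod n) (Rot, True) @ [(Flip, True)])"
        by simp
      from pres_eq_append[OF this pres_eq.refl[of R ?t]]
      have "pres_eq R (l # dih_canon x) (replicate ((m * (n - 1)) mod n) (Rot, True) @ (Flip, True) # ?t)"
        by (simp add: xm dih_canon_def)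
      moreover have "pres_eq R ((Flip, True) # ?t) (if e then [] else [(Flip, True)])"
        using ss pres_eq.refl by auto
      ultimately have "pres_eq R (l # dih_canon x)
        (replicate ((m * (n - 1)) mod n) (Rot, True) @ (if e then [] else [(Flip, True)]))"
        by (rule tr[OF _ pres_eq_append[OF pres_eq.refl]])
      then show ?thesis
        using 3 by (cases e) (simp_all add: l xm dih_canon_def neg)
    qed
  qed
  have canon: "pres_eq R w (dih_canon (dih_eval n w (0, False)))" for w
  proof (induction w)
    case Nil
    show ?case by (simp add: dih_eval_def dih_canon_def pres_eq.refl)
  next
    case (Cons l w)
    have "dih_eval n w (0, False) \<in> dih_states n"
      using assms by (intro dih_eval_states) auto
    from tr[OF pres_eq_append[OF pres_eq.refl[of R "[l]"] Cons]] step[OF this, of l]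
    show ?case by (simp add: dih_eval_def)
  qed
  have "bij_betw (\<lambda>x. ?c (dih_canon x)) (dih_states n) (range ?c)"
  proof (rule bij_betw_imageI)
    show "inj_on (\<lambda>x. ?c (dih_canon x)) (dih_states n)"
    proof (rule inj_onI)
      fix x y assume xy: "x \<in> dih_states n" "y \<in> dih_states n"
        and "?c (dih_canon x) = ?c (dih_canon y)"
      then have "dih_eval n (dih_canon x) (0, False) = dih_eval n (dih_canon y) (0, False)"
        using assms by (intro dih_eval_respects) (auto simp: pres_class_eq R_def)
      with xy show "x = y" by (simp only: dih_eval_canon)
    qed
    show "(\<lambda>x. ?c (dih_canon x)) ` dih_states n = range ?c"
    proof (intro equalityI subsetI)
      fix y assume "y \<in> range ?c"
      then obtain w where "y = ?c w" by auto
      with canon have "y = ?c (dih_canon (dih_eval n w (0, False)))"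
        by (simp add: pres_class_eq)
      moreover have "dih_eval n w (0, False) \<in> dih_states n"
        using assms by (intro dih_eval_states) auto
      ultimately show "y \<in> (\<lambda>x. ?c (dih_canon x)) ` dih_states n" by (rule image_eqI)
    qed auto
  qed
  from bij_betw_same_card[OF this] show ?thesis
    by (simp add: order_def dihedral_group_def carrier_presented_group R_def card_cartesian_product)
qed


section \<open>Intersection graph and eccentric connectivity index\<close>

text \<open>
  Simple graphs are represented as symmetric loop-free digraphs: an edge between \<open>H\<close> and
  \<open>K\<close> is the pair of arcs \<open>(H, K)\<close>, \<open>(K, H)\<close>, so that the degree of a vertex is its
  out-degree.
\<close>

definition intersection_graph :: "('a, 'b) monoid_scheme \<Rightarrow> 'a set pair_pre_digraph" where
  "intersection_graph G =
    (let V = {H. subgroup H G \<and> H \<noteq> {\<one>\<^bsub>G\<^esub>} \<and> H \<noteq> carrier G}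
     in \<lparr> pverts = V,
          parcs = {(H, K). H \<in> V \<and> K \<in> V \<and> H \<noteq> K \<and> H \<inter> K \<noteq> {\<one>\<^bsub>G\<^esub>}} \<rparr>)"

lemma pair_wf_intersection_graph: "pair_wf_digraph (intersection_graph G)"
  by (rule pair_wf_digraph.intro) (simp_all add: intersection_graph_def Let_def case_prod_beta)

lemma symmetric_intersection_graph: "symmetric (with_proj (intersection_graph G))"
  unfolding symmetric_def with_proj_simps
  by (rule symI) (simp add: intersection_graph_def Let_def Int_commute eq_commute)

text \<open>
  The length of a shortest walk; it is \<open>\<infinity>\<close> if there is none.
\<close>

definition graph_dist :: "'v pair_pre_digraph \<Rightarrow> 'v \<Rightarrow> 'v \<Rightarrow> ereal" where
  "graph_dist \<Gamma> u v = wf_digraph.\<mu> (with_proj \<Gamma>) (\<lambda>_. 1) u v"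

text \<open>
  The supremum may include \<open>v\<close> itself, since \<open>v\<close> has distance \<open>0\<close> from itself; this makes
  the eccentricity \<open>0\<close> in a graph with a single vertex.
\<close>

definition ecc :: "'v pair_pre_digraph \<Rightarrow> 'v \<Rightarrow> ereal" where
  "ecc \<Gamma> v = (SUP w\<in>pverts \<Gamma>. graph_dist \<Gamma> v w)"

definition eccentric_connectivity_index :: "'v pair_pre_digraph \<Rightarrow> ereal" where
  "eccentric_connectivity_index \<Gamma> =
    (\<Sum>v\<in>pverts \<Gamma>. ereal (real (out_degree (with_proj \<Gamma>) v)) * ecc \<Gamma> v)"

end

(*
  A subgroup of the dihedral group meets the rotations in the subgroup generated by r^d for some
  d dividing n, and its reflections, if any, form one coset of that subgroup.  For n = p^2 the
  vertices are therefore <r>, <r^p>, the p subgroups <r^p, r^b s> and the p^2 subgroups <r^j s>.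
  The first p + 2 contain r^p and form a clique; each <r^j s> is a leaf attached to
  <r^p, r^j s>, and every <r^p, r^b s> carries p leaves.  So the degrees are p + 1 (twice),
  2p + 1 (p times) and 1 (p^2 times), with eccentricities 2, 2 and 3.
*)

theory Submission
  imports Defs
begin

section \<open>Distances and degrees in pair digraphs\<close>

context pair_wf_digraph
begin

text \<open>Turns every distance question into one about powers of the arc relation. The condition
  \<open>u \<in> pverts G\<close> is for \<open>m = 0\<close>, where the power is the full identity
  but an empty walk exists only at a vertex.\<close>

lemma ex_awalk_iff_relpow:
  "(\<exists>q. awalk u q v \<and> length q = m) \<longleftrightarrow> u \<in> pverts G \<and> (u, v) \<in> parcs G ^^ m"
proof (induction m arbitrary: u)
  case 0
  show ?case by (auto simp: awalk_Nil_iff)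
next
  case (Suc m)
  have "(\<exists>q. awalk u q v \<and> length q = Suc m) \<longleftrightarrow>
      (\<exists>e q. awalk u (e # q) v \<and> length q = m)"
    by (metis length_Suc_conv)
  also have "\<dots> \<longleftrightarrow> (\<exists>x. (u, x) \<in> parcs G \<and> (\<exists>q. awalk x q v \<and> length q = m))"
    unfolding awalk_Cons_iff by force
  also have "\<dots> \<longleftrightarrow> u \<in> pverts G \<and> (u, v) \<in> parcs G ^^ Suc m"
    \<comment> \<open>\<open>relpow\<close> splits off the last arc by definition, a walk its first
      one; commutation moves the split to the front.\<close>
    unfolding Suc relpow.simps(2) unfolding relpow_commute[symmetric]
    using in_arcsD1 in_arcsD2 by blast
  finally show ?case .
qed

lemma awalk_cost_unit: "awalk_cost (\<lambda>_. 1) q = real (length q)"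
  by (induction q) auto

lemma graph_dist_le:
  assumes "u \<in> pverts G" "(u, v) \<in> parcs G ^^ m"
  shows "graph_dist G u v \<le> ereal (real m)"
proof -
  obtain q where "awalk u q v" "length q = m"
    using assms ex_awalk_iff_relpow by blast
  then show ?thesis
    using min_cost_le_walk_cost[of u q v "\<lambda>_. 1"] by (simp add: graph_dist_def awalk_cost_unit)
qed

text \<open>\<open>\<mu>\<close> is an infimum over walks, and a walk of length \<open>m\<close>
  puts the pair into the \<open>m\<close>-th power. Without any walk the infimum is \<infinity> and
  the bound persists.\<close>

lemma graph_dist_ge:
  assumes "\<And>m. m < k \<Longrightarrow> (u, v) \<notin> parcs G ^^ m"
  shows "ereal (real k) \<le> graph_dist G u v"
  unfolding graph_dist_def \<mu>_def
proof (rule INF_greatest)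
  fix q assume "q \<in> {q. awalk u q v}"
  then have "(u, v) \<in> parcs G ^^ length q"
    using ex_awalk_iff_relpow by blast
  with assms have "k \<le> length q" using not_less by blast
  then show "ereal (real k) \<le> ereal (awalk_cost (\<lambda>_. 1) q)"
    by (simp add: awalk_cost_unit)
qed

text \<open>The scheme for both eccentricities. A power of the arc relation describes walks of one
  exact length, hence the existential over \<open>m \<le> k\<close>.\<close>

lemma ecc_eqI:
  assumes v: "v \<in> pverts G"
    and le: "\<And>w. w \<in> pverts G \<Longrightarrow> \<exists>m\<le>k. (v, w) \<in> parcs G ^^ m"
    and far: "w \<in> pverts G" "\<And>m. m < k \<Longrightarrow> (v, w) \<notin> parcs G ^^ m"
  shows "ecc G v = ereal (real k)"
proof (rule antisym)
  show "ecc G v \<le> ereal (real k)"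
    unfolding ecc_def
  proof (rule SUP_least)
    fix w assume "w \<in> pverts G"
    then obtain m where "m \<le> k" "(v, w) \<in> parcs G ^^ m" using le by blast
    then show "graph_dist G v w \<le> ereal (real k)"
      using graph_dist_le[OF v] by (meson ereal_less_eq(3) of_nat_mono order_trans)
  qed
  show "ereal (real k) \<le> ecc G v"
    unfolding ecc_def using far by (meson SUP_upper2 graph_dist_ge)
qed

lemma out_degree_eq_card: "out_degree G v = card (parcs G `` {v})"
proof -
  have "out_arcs G v = Pair v ` (parcs G `` {v})" by force
  then show ?thesis by (simp add: out_degree_def card_image inj_on_def)
qed

end

section \<open>Rotations and reflections\<close>

lemma dvd_diff_iff:
  fixes d i j b :: int
  assumes "d dvd i - j"
  shows "d dvd i - b \<longleftrightarrow> d dvd j - b"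
proof -
  have "i - b = (i - j) + (j - b)" by simp
  then show ?thesis by (metis assms dvd_add_right_iff)
qed

lemma dvd_diff_less_eq:
  fixes i j m :: int
  assumes "m dvd i - j" "i \<in> {0..<m}" "j \<in> {0..<m}"
  shows "i = j"
  using assms by (metis atLeastLessThan_iff mod_eq_dvd_iff mod_pos_pos_trivial)

text \<open>Conjugation by \<open>y\<close> inverts \<open>x\<close>, hence every power of
  \<open>x\<close>. In the dihedral group this moves s past the powers of r.\<close>

lemma (in group) conj_inv_int_pow:
  fixes k :: int
  assumes x: "x \<in> carrier G" and y: "y \<in> carrier G" and yx: "y \<otimes> x = inv x \<otimes> y"
  shows "y \<otimes> x [^] k = x [^] (- k) \<otimes> y"
proof -
  have nat: "y \<otimes> x [^] int m = x [^] (- int m) \<otimes> y" for m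
  proof (induction m)
    case 0
    show ?case using x y by simp
  next
    case (Suc m)
    have "y \<otimes> x [^] int (Suc m) = (y \<otimes> x [^] int m) \<otimes> x"
      using x y by (simp add: int_pow_mult m_assoc add.commute[of 1] flip: int_pow_int)
    also have "\<dots> = x [^] (- int m) \<otimes> (inv x \<otimes> y)"
      using x y by (simp add: Suc m_assoc yx)
    also have "\<dots> = x [^] (- int m + (- 1)) \<otimes> y"
      unfolding int_pow_mult[OF x] using x y by (simp add: m_assoc int_pow_neg)
    finally show ?case by (simp add: add.commute)
  qed
  have neg: "y \<otimes> x [^] (- int m) = x [^] int m \<otimes> y" for m
  proof -
    \<comment> \<open>The case of natural exponents turns the middle factor into
      \<open>y \<otimes> x [^] int m\<close>, whose power of \<open>x\<close> cancels against the
      last factor.\<close>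
    have "y \<otimes> x [^] (- int m) = x [^] int m \<otimes> (x [^] (- int m) \<otimes> y) \<otimes> x [^] (- int m)"
      using x y by (simp add: int_pow_neg flip: m_assoc)
    also have "\<dots> = x [^] int m \<otimes> y"
      unfolding nat[symmetric] using x y by (simp add: int_pow_neg m_assoc)
    finally show ?thesis .
  qed
  show ?thesis
    using nat[of "nat k"] neg[of "nat (- k)"] by (cases "k \<ge> 0") auto
qed

text \<open>\<open>\<rho> k\<close> and \<open>\<sigma> k\<close> stand for \<open>r\<^sup>k\<close> and \<open>r\<^sup>k s\<close>.\<close>

locale dihedral = group G for G (structure) +
  fixes n :: nat and \<rho> \<sigma> :: "int \<Rightarrow> 'a"
  assumes n_pos: "n > 0"
    and carrier_eq: "carrier G = range \<rho> \<union> range \<sigma>"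
    and mult_simps [simp]:
      "\<rho> i \<otimes> \<rho> j = \<rho> (i + j)" "\<rho> i \<otimes> \<sigma> j = \<sigma> (i + j)"
      "\<sigma> i \<otimes> \<rho> j = \<sigma> (i - j)" "\<sigma> i \<otimes> \<sigma> j = \<rho> (i - j)"
    and rot_eq_iff: "\<rho> i = \<rho> j \<longleftrightarrow> int n dvd i - j"
    and ref_eq_iff: "\<sigma> i = \<sigma> j \<longleftrightarrow> int n dvd i - j"
    and rot_neq_ref [simp]: "\<rho> i \<noteq> \<sigma> j"
begin

lemma ref_neq_rot [simp]: "\<sigma> i \<noteq> \<rho> j"
  using rot_neq_ref by metis

lemma rot_closed [simp]: "\<rho> i \<in> carrier G" and ref_closed [simp]: "\<sigma> i \<in> carrier G"
  by (simp_all add: carrier_eq)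

lemma rot_0: "\<rho> 0 = \<one>"
  using mult_simps(1)[of 0 0] l_cancel_one[of "\<rho> 0" "\<rho> 0"] by simp

lemma inv_rot [simp]: "inv (\<rho> i) = \<rho> (- i)"
  by (rule inv_equality) (simp_all add: rot_0)

lemma inv_ref [simp]: "inv (\<sigma> i) = \<sigma> i"
  by (rule inv_equality) (simp_all add: rot_0)

section \<open>Subgroups described by exponents\<close>

text \<open>The subgroup generated by r^d, given by all integer exponents so that membership becomes
  divisibility.\<close>

definition rot_sub :: "nat \<Rightarrow> 'a set" where
  "rot_sub d = \<rho> ` {k. int d dvd k}"

text \<open>The subgroup generated by r^d and r^b s. For \<open>d = n\<close> its only elements are
  \<open>\<one>\<close> and \<open>\<sigma> b\<close>.\<close>

definition dih_sub :: "nat \<Rightarrow> int \<Rightarrow> 'a set" where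
  "dih_sub d b = rot_sub d \<union> \<sigma> ` {k. int d dvd k - b}"

text \<open>An element determines its exponent only modulo \<open>n\<close>; since \<open>d\<close>
  divides \<open>n\<close>, divisibility by \<open>d\<close> does not depend on the exponent
  chosen.\<close>

lemma mem_sub_simps:
  assumes "d dvd n"
  shows "\<rho> k \<in> rot_sub d \<longleftrightarrow> int d dvd k" "\<sigma> k \<notin> rot_sub d"
    "\<rho> k \<in> dih_sub d b \<longleftrightarrow> int d dvd k" "\<sigma> k \<in> dih_sub d b \<longleftrightarrow> int d dvd k - b"
proof -
  have *: "int d dvd k - b \<longleftrightarrow> int d dvd l - b" if "int n dvd k - l" for k l b
    using that assms dvd_diff_iff dvd_trans int_dvd_int_iff by metis
  show r: "\<rho> k \<in> rot_sub d \<longleftrightarrow> int d dvd k" for k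
    using *[of k _ 0] by (auto simp: rot_sub_def rot_eq_iff)
  show s: "\<sigma> k \<notin> rot_sub d" for k
    by (auto simp: rot_sub_def)
  show "\<rho> k \<in> dih_sub d b \<longleftrightarrow> int d dvd k"
    by (simp add: dih_sub_def r image_iff)
  show "\<sigma> k \<in> dih_sub d b \<longleftrightarrow> int d dvd k - b"
    using s * by (auto simp: dih_sub_def ref_eq_iff)
qed

lemma set_eq_iff_exponents:
  assumes "A \<subseteq> carrier G" "B \<subseteq> carrier G"
  shows "A = B \<longleftrightarrow> (\<forall>k. \<rho> k \<in> A \<longleftrightarrow> \<rho> k \<in> B) \<and> (\<forall>k. \<sigma> k \<in> A \<longleftrightarrow> \<sigma> k \<in> B)"
  using assms unfolding carrier_eq by blast

lemma sub_subset_carrier: "rot_sub d \<subseteq> carrier G" "dih_sub d b \<subseteq> carrier G"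
  by (auto simp: rot_sub_def dih_sub_def)

lemma subgroup_rot_sub: "subgroup (rot_sub d) G"
  by (rule subgroupI) (auto simp: rot_sub_def)

lemma subgroup_dih_sub: "subgroup (dih_sub d b) G"
proof (rule subgroupI)
  show "dih_sub d b \<noteq> {}" by (auto simp: dih_sub_def rot_sub_def)
next
  fix x y assume "x \<in> dih_sub d b" "y \<in> dih_sub d b"
  then consider i j where "x = \<rho> i" "int d dvd i" "y = \<rho> j" "int d dvd j"
    | i j where "x = \<rho> i" "int d dvd i" "y = \<sigma> j" "int d dvd j - b"
    | i j where "x = \<sigma> i" "int d dvd i - b" "y = \<rho> j" "int d dvd j"
    | i j where "x = \<sigma> i" "int d dvd i - b" "y = \<sigma> j" "int d dvd j - b"
    by (auto simp: dih_sub_def rot_sub_def)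
  then show "x \<otimes> y \<in> dih_sub d b"
  proof cases
    case 1
    then show ?thesis by (simp add: dih_sub_def rot_sub_def)
  next
    case 2
    have "int d dvd i + (j - b)" using 2 by (intro dvd_add)
    then show ?thesis using 2 by (simp add: dih_sub_def add_diff_eq)
  next
    case 3
    have "int d dvd (i - b) - j" by (rule dvd_diff[OF 3(2,4)])
    then have "int d dvd i - j - b" by (simp add: algebra_simps)
    then show ?thesis using 3 by (simp add: dih_sub_def)
  next
    case 4
    have "int d dvd (i - b) - (j - b)" by (rule dvd_diff[OF 4(2,4)])
    then show ?thesis using 4 by (simp add: dih_sub_def rot_sub_def)
  qed
qed (auto simp: dih_sub_def rot_sub_def)

text \<open>Permits choosing the index in \<open>{0..<int d}\<close>.\<close>

lemma dih_sub_cong: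
  assumes "int d dvd b - c"
  shows "dih_sub d b = dih_sub d c"
proof -
  have "int d dvd k - b \<longleftrightarrow> int d dvd k - c" for k
    using dvd_diff_iff[OF assms, of k] dvd_diff_commute by metis
  then show ?thesis by (simp add: dih_sub_def)
qed

text \<open>The exponents of the rotations in \<open>H\<close> form a subgroup of the integers
  containing \<open>n\<close>; it consists of the multiples of its least positive element.\<close>

lemma subgroup_rot_exponents:
  assumes H: "subgroup H G"
  obtains d where "d dvd n" "\<And>k. \<rho> k \<in> H \<longleftrightarrow> int d dvd k"
proof -
  note HE = subgroupE[OF H]
  have add: "\<rho> (i + j) \<in> H" if "\<rho> i \<in> H" "\<rho> j \<in> H" for i j
    using HE(4)[OF that] by simp
  have neg: "\<rho> (- i) \<in> H" if "\<rho> i \<in> H" for i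
    using HE(3)[OF that] by simp
  have zero: "\<rho> 0 \<in> H" using subgroup.one_closed[OF H] by (simp add: rot_0)
  have mul: "\<rho> (int m * i) \<in> H" if "\<rho> i \<in> H" for m i
    by (induction m) (use zero add that in \<open>auto simp: distrib_right\<close>)
  have mulz: "\<rho> (z * i) \<in> H" if "\<rho> i \<in> H" for z i
    using mul[OF that, of "nat \<bar>z\<bar>"] neg[OF mul[OF that, of "nat \<bar>z\<bar>"]] by (cases "z \<ge> 0") auto
  have n: "\<rho> (int n) \<in> H"
    using zero rot_eq_iff[of "int n" 0] by simp
  define d where "d = (LEAST d. d > 0 \<and> \<rho> (int d) \<in> H)"
  have d: "d > 0" "\<rho> (int d) \<in> H"
    using LeastI[of "\<lambda>d. d > 0 \<and> \<rho> (int d) \<in> H" n] n n_pos by (auto simp: d_def)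
  have iff: "\<rho> k \<in> H \<longleftrightarrow> int d dvd k" for k
  proof
    assume k: "\<rho> k \<in> H"
    \<comment> \<open>Division with remainder: the remainder of \<open>k\<close> is again an
      exponent from \<open>H\<close>, below the least positive one, hence zero.\<close>
    have "\<rho> (k + - (k div int d * int d)) \<in> H"
      using k d by (intro add neg mulz)
    then have "\<rho> (int (nat (k mod int d))) \<in> H"
      using d by (simp add: minus_div_mult_eq_mod)
    moreover have "nat (k mod int d) < d" using d by (simp add: nat_less_iff)
    ultimately have "nat (k mod int d) = 0"
      using not_less_Least[of "nat (k mod int d)" "\<lambda>d. d > 0 \<and> \<rho> (int d) \<in> H"]
      by (auto simp: d_def)
    then have "k mod int d = 0" using d pos_mod_sign[of "int d" k] by linarith
    then show "int d dvd k" by (rule mod_0_imp_dvd)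
  next
    assume "int d dvd k"
    then show "\<rho> k \<in> H" using mulz[OF d(2)] by (auto simp: mult.commute)
  qed
  moreover have "d dvd n" using iff[of "int n"] n by simp
  ultimately show ?thesis using that by blast
qed

text \<open>Multiplying by one reflection \<open>\<sigma> b\<close> of \<open>H\<close> exchanges
  its rotations and reflections, so the exponents of the reflections form one residue class modulo
  \<open>d\<close>.\<close>

lemma subgroup_iff:
  "subgroup H G \<longleftrightarrow> (\<exists>d. d dvd n \<and> (H = rot_sub d \<or> (\<exists>b\<in>{0..<int d}. H = dih_sub d b)))"
proof
  assume H: "subgroup H G"
  note HE = subgroupE[OF H]
  obtain d where d: "d dvd n" "\<And>k. \<rho> k \<in> H \<longleftrightarrow> int d dvd k"
    using subgroup_rot_exponents[OF H] by blast
  show "\<exists>d. d dvd n \<and> (H = rot_sub d \<or> (\<exists>b\<in>{0..<int d}. H = dih_sub d b))"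
  proof (cases "\<exists>b. \<sigma> b \<in> H")
    case True
    then obtain b where b: "\<sigma> b \<in> H" by blast
    \<comment> \<open>The two products are
      \<open>\<sigma> k \<otimes> \<sigma> b = \<rho> (k - b)\<close> and
      \<open>\<rho> (k - b) \<otimes> \<sigma> b = \<sigma> k\<close>.\<close>
    have "\<sigma> k \<in> H \<longleftrightarrow> int d dvd k - b" for k
      using HE(4)[OF _ b, of "\<sigma> k"] HE(4)[OF _ b, of "\<rho> (k - b)"] d(2) by auto
    then have "H = dih_sub d b"
      using d by (subst set_eq_iff_exponents) (auto simp: HE(1) sub_subset_carrier mem_sub_simps)
    also have "\<dots> = dih_sub d (b mod int d)"
      by (rule dih_sub_cong) (simp add: minus_mod_eq_mult_div)
    finally show ?thesis
      using d n_pos by (intro exI[of _ d] conjI disjI2 bexI[of _ "b mod int d"])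
        (auto simp: dvd_pos_nat)
  next
    case False
    then have "H = rot_sub d"
      using d by (subst set_eq_iff_exponents) (auto simp: HE(1) sub_subset_carrier mem_sub_simps)
    then show ?thesis using d by blast
  qed
qed (auto simp: subgroup_rot_sub subgroup_dih_sub)

text \<open>Adjacency becomes a test on exponents: a reflection is never the identity, and
  \<open>\<rho> k\<close> is the identity just when \<open>n\<close> divides
  \<open>k\<close>.\<close>

lemma Int_nontrivial_iff:
  assumes "subgroup H G" "subgroup K G"
  shows "H \<inter> K \<noteq> {\<one>} \<longleftrightarrow>
    (\<exists>k. \<not> int n dvd k \<and> \<rho> k \<in> H \<inter> K) \<or> (\<exists>k. \<sigma> k \<in> H \<inter> K)"
proof -
  have sub: "subgroup (H \<inter> K) G" by (rule subgroups_Inter_pair[OF assms])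
  have "H \<inter> K \<noteq> {\<one>} \<longleftrightarrow> (\<exists>x\<in>H \<inter> K. x \<noteq> \<one>)"
    using subgroup.one_closed[OF sub] by blast
  also have "\<dots> \<longleftrightarrow> (\<exists>k. \<rho> k \<noteq> \<rho> 0 \<and> \<rho> k \<in> H \<inter> K) \<or> (\<exists>k. \<sigma> k \<noteq> \<rho> 0 \<and> \<sigma> k \<in> H \<inter> K)"
    using subgroup.subset[OF sub] unfolding carrier_eq rot_0 by blast
  finally show ?thesis by (simp add: rot_eq_iff)
qed

end

section \<open>From the presentation to rotations and reflections\<close>

text \<open>The relations yield the multiplication rules and show that every element is some
  \<open>\<rho> k\<close> or \<open>\<sigma> k\<close>. Uniqueness comes from counting:
  \<open>2 * n\<close> normal forms cover a group of order \<open>2 * n\<close>, so the covering map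
  is injective.\<close>

lemma dihedral_dihedral_group:
  assumes n: "n > 0"
  obtains \<rho> \<sigma> where "dihedral (dihedral_group n) n \<rho> \<sigma>"
proof -
  define R where "R = dihedral_relations n"
  define G where "G = dihedral_group n"
  interpret group G unfolding G_def by (rule group_dihedral_group)
  let ?c = "\<lambda>w. pres_rel R `` {w}"
  have carr: "carrier G = range ?c"
    by (simp add: G_def R_def dihedral_group_def carrier_presented_group)
  have mult: "?c u \<otimes>\<^bsub>G\<^esub> ?c v = ?c (u @ v)" for u v
    by (simp add: G_def R_def dihedral_group_def presented_group_mult)
  have one: "\<one>\<^bsub>G\<^esub> = ?c []"
    by (simp add: G_def R_def dihedral_group_def one_presented_group)
  have rel: "?c a = ?c b" if "(a, b) \<in> R" for a b
    using pres_eq.relation[OF that, of "[]" "[]"] by (simp add: pres_class_eq)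
  define r where "r = ?c [(Rot, True)]"
  define s where "s = ?c [(Flip, True)]"
  have cl [simp]: "r \<in> carrier G" "s \<in> carrier G" by (auto simp: carr r_def s_def)
  have canc: "?c [(x, False)] \<otimes>\<^bsub>G\<^esub> ?c [(x, True)] = \<one>\<^bsub>G\<^esub>" for x
    using pres_eq.cancel[of R "[]" x False "[]"] by (simp add: mult one pres_class_eq)
  have inv_r: "inv\<^bsub>G\<^esub> r = ?c [(Rot, False)]"
    by (rule inv_equality) (use canc in \<open>auto simp: r_def carr\<close>)
  have inv_s: "inv\<^bsub>G\<^esub> s = ?c [(Flip, False)]"
    by (rule inv_equality) (use canc in \<open>auto simp: s_def carr\<close>)
  have ss: "s \<otimes>\<^bsub>G\<^esub> s = \<one>\<^bsub>G\<^esub>"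
    by (simp add: s_def mult one) (rule rel, simp add: R_def dihedral_relations_def)
  then have inv_s': "inv\<^bsub>G\<^esub> s = s" by (simp add: inv_equality)
  have "s \<otimes>\<^bsub>G\<^esub> r \<otimes>\<^bsub>G\<^esub> s = inv\<^bsub>G\<^esub> r"
    unfolding inv_r by (simp add: s_def mult r_def) (rule rel, simp add: R_def dihedral_relations_def)
  then have "inv\<^bsub>G\<^esub> r \<otimes>\<^bsub>G\<^esub> s = s \<otimes>\<^bsub>G\<^esub> r \<otimes>\<^bsub>G\<^esub> s \<otimes>\<^bsub>G\<^esub> s" by simp
  also have "\<dots> = s \<otimes>\<^bsub>G\<^esub> r" by (simp add: m_assoc ss)
  finally have sr: "s \<otimes>\<^bsub>G\<^esub> r = inv\<^bsub>G\<^esub> r \<otimes>\<^bsub>G\<^esub> s" by simp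
  have srk: "s \<otimes>\<^bsub>G\<^esub> r [^]\<^bsub>G\<^esub> k = r [^]\<^bsub>G\<^esub> (- k) \<otimes>\<^bsub>G\<^esub> s" for k :: int
    by (rule conj_inv_int_pow) (simp_all add: sr)
  have "r [^]\<^bsub>G\<^esub> m = ?c (replicate m (Rot, True))" for m :: nat
    by (induction m) (simp_all add: one mult r_def replicate_append_same)
  then have rn: "r [^]\<^bsub>G\<^esub> n = \<one>\<^bsub>G\<^esub>"
    by (simp add: one) (rule rel, simp add: R_def dihedral_relations_def)
  define \<rho> where "\<rho> = (\<lambda>k::int. r [^]\<^bsub>G\<^esub> k)"
  define \<sigma> where "\<sigma> = (\<lambda>k. \<rho> k \<otimes>\<^bsub>G\<^esub> s)"
  have \<rho>cl [simp]: "\<rho> k \<in> carrier G" and \<sigma>cl [simp]: "\<sigma> k \<in> carrier G" for k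
    by (simp_all add: \<rho>_def \<sigma>_def)
  have rr: "\<rho> i \<otimes>\<^bsub>G\<^esub> \<rho> j = \<rho> (i + j)" for i j
    by (simp add: \<rho>_def int_pow_mult)
  have rs: "\<rho> i \<otimes>\<^bsub>G\<^esub> \<sigma> j = \<sigma> (i + j)" for i j
    by (simp add: \<sigma>_def flip: rr m_assoc)
  have s\<rho>: "s \<otimes>\<^bsub>G\<^esub> \<rho> j = \<rho> (- j) \<otimes>\<^bsub>G\<^esub> s" for j
    using srk by (simp add: \<rho>_def)
  have sr': "\<sigma> i \<otimes>\<^bsub>G\<^esub> \<rho> j = \<sigma> (i - j)" for i j
  proof -
    have "\<sigma> i \<otimes>\<^bsub>G\<^esub> \<rho> j = \<rho> i \<otimes>\<^bsub>G\<^esub> (\<rho> (- j) \<otimes>\<^bsub>G\<^esub> s)"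
      by (simp add: \<sigma>_def m_assoc s\<rho>)
    also have "\<dots> = \<sigma> (i - j)"
      using rs[of i "- j"] by (simp add: \<sigma>_def)
    finally show ?thesis .
  qed
  have ss': "\<sigma> i \<otimes>\<^bsub>G\<^esub> \<sigma> j = \<rho> (i - j)" for i j
  proof -
    have "\<sigma> i \<otimes>\<^bsub>G\<^esub> \<sigma> j = (\<sigma> i \<otimes>\<^bsub>G\<^esub> \<rho> j) \<otimes>\<^bsub>G\<^esub> s"
      by (simp add: \<sigma>_def m_assoc)
    also have "\<dots> = \<rho> (i - j)" unfolding sr' by (simp add: \<sigma>_def m_assoc ss)
    finally show ?thesis .
  qed
  have gens: "r = \<rho> 1" "inv\<^bsub>G\<^esub> r = \<rho> (- 1)" "s = \<sigma> 0"
    by (simp_all add: \<rho>_def \<sigma>_def int_pow_neg)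
  have letter: "?c [l] \<in> {\<rho> 1, \<rho> (- 1), \<sigma> 0}" for l
  proof (cases l)
    case (Pair g b)
    then show ?thesis
      using gens inv_r inv_s inv_s' by (cases g; cases b) (auto simp: r_def s_def)
  qed
  have gen: "?c w \<in> range \<rho> \<union> range \<sigma>" for w
  proof (induction w)
    case Nil
    have "?c [] = \<rho> 0" by (simp add: \<rho>_def one)
    then show ?case by simp
  next
    case (Cons l w)
    have "?c (l # w) = ?c [l] \<otimes>\<^bsub>G\<^esub> ?c w" by (simp add: mult)
    then show ?case using letter[of l] Cons by (auto simp: rr rs sr' ss')
  qed
  have C: "carrier G = range \<rho> \<union> range \<sigma>"
    using gen \<rho>cl \<sigma>cl unfolding carr by blast
  have "\<rho> (int n * k) = \<one>\<^bsub>G\<^esub>" for k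
    unfolding \<rho>_def using int_pow_pow[of r "int n" k] rn by (simp add: int_pow_int)
  then have \<rho>mod: "\<rho> (k mod int n) = \<rho> k" for k
    using rr[of "k mod int n" "int n * (k div int n)"] by simp
  then have \<sigma>mod: "\<sigma> (k mod int n) = \<sigma> k" for k by (simp add: \<sigma>_def)
  let ?f = "\<lambda>(k, e). if e then \<sigma> k else \<rho> k"
  have im: "?f ` dih_states n = carrier G"
  proof
    show "carrier G \<subseteq> ?f ` dih_states n"
    proof
      fix x assume "x \<in> carrier G"
      then obtain k where "x = \<rho> k \<or> x = \<sigma> k" using C by auto
      \<comment> \<open>Rotations and reflections are not yet known to be distinct, so the flag
        takes the rotation whenever it fits.\<close>
      then have "x = ?f (k mod int n, x \<noteq> \<rho> k)" by (auto simp: \<rho>mod \<sigma>mod)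
      then show "x \<in> ?f ` dih_states n" using n by (intro image_eqI) auto
    qed
  qed auto
  have inj: "inj_on ?f (dih_states n)"
  proof (rule eq_card_imp_inj_on)
    show "card (?f ` dih_states n) = card (dih_states n)"
      unfolding im using order_dihedral_group[OF n]
      by (simp add: order_def G_def card_cartesian_product)
  qed simp
  have st: "(k mod int n, e) \<in> dih_states n" for k e using n by simp
  \<comment> \<open>Equal flags will give the two congruence criteria, different flags the
    disjointness of rotations and reflections.\<close>
  have key: "(if e then \<sigma> i else \<rho> i) = (if e' then \<sigma> j else \<rho> j) \<longleftrightarrow> int n dvd i - j \<and> e = e'"
    for i j e e'
    using inj_on_eq_iff[OF inj st st, of i e j e'] by (cases e; cases e') (simp_all add: \<rho>mod \<sigma>mod mod_eq_dvd_iff)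
  have "dihedral G n \<rho> \<sigma>"
    using n C rr rs sr' ss' key[of False _ False] key[of True _ True] key[of False _ True]
    by unfold_locales auto
  then show ?thesis using that by (simp add: G_def)
qed

section \<open>The intersection graph for the square of a prime\<close>

locale dihedral_prime_square = dihedral +
  fixes p :: nat
  assumes p: "prime p" and n_eq: "n = p ^ 2"
begin

abbreviation "\<Gamma> \<equiv> intersection_graph G"
abbreviation "P \<equiv> {0..<int p}"
abbreviation "N \<equiv> {0..<int n}"

sublocale pair_wf_digraph \<Gamma>
  by (rule pair_wf_intersection_graph)

lemma p_gt_1: "p > 1" and n_gt_p: "n > p"
  using p prime_gt_1_nat[of p] by (auto simp: n_eq power2_eq_square)

lemma dvds [simp]: "Suc 0 dvd n" "p dvd n" "n dvd n"
  by (simp_all add: n_eq)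

lemma not_dvds [simp]: "\<not> int n dvd 1" "\<not> int p dvd 1" "\<not> int n dvd int p" "\<not> n dvd p"
  "p \<noteq> Suc 0" "n \<noteq> Suc 0"
  using p_gt_1 n_gt_p by (auto dest: zdvd_imp_le dvd_imp_le)

section \<open>The vertices\<close>

lemma dvd_n_iff: "d dvd n \<longleftrightarrow> d \<in> {1, p, n}"
proof -
  have "d dvd n \<longleftrightarrow> (\<exists>i\<le>2. d = p ^ i)"
    unfolding n_eq by (rule divides_primepow_nat[OF p])
  also have "(\<exists>i\<le>2. Q i) \<longleftrightarrow> Q 0 \<or> Q 1 \<or> Q 2" for Q :: "nat \<Rightarrow> bool"
    by (auto simp: le_Suc_eq numeral_2_eq_2)
  finally have "d dvd n \<longleftrightarrow> d = p ^ 0 \<or> d = p ^ 1 \<or> d = p ^ 2" .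
  then show ?thesis by (simp add: n_eq)
qed

text \<open>\<open>big\<close> consists of the vertices containing \<open>r\<^sup>p\<close>; the remaining ones are generated
  by a reflection.\<close>

definition big :: "'a set set" where
  "big = {rot_sub 1, rot_sub p} \<union> dih_sub p ` P"

definition small :: "'a set set" where
  "small = dih_sub n ` N"

lemma rot_p_mem_big: "H \<in> big \<Longrightarrow> \<rho> (int p) \<in> H"
  by (auto simp: big_def mem_sub_simps)

lemma rot_mem_small: "H \<in> small \<Longrightarrow> \<rho> k \<in> H \<longleftrightarrow> int n dvd k"
  by (auto simp: small_def mem_sub_simps)

text \<open>Every member of \<open>big\<close> contains \<open>\<rho> (int p)\<close>, and no member
  of \<open>small\<close> does, as \<open>n\<close> does not divide \<open>p\<close>.\<close>

lemma big_Int_small: "big \<inter> small = {}"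
  using rot_p_mem_big rot_mem_small by fastforce

text \<open>\<open>\<sigma> b\<close> lies in \<open>dih_sub d b\<close>, so equal subgroups have
  congruent indices, and congruent reduced indices are equal.\<close>

lemma inj_dih_sub: "inj_on (dih_sub p) P" "inj_on (dih_sub n) N"
proof -
  have "inj_on (dih_sub d) {0..<int d}" if d: "d dvd n" for d
  proof (rule inj_onI)
    fix b c assume bc: "b \<in> {0..<int d}" "c \<in> {0..<int d}" and "dih_sub d b = dih_sub d c"
    then have "int d dvd b - c"
      using mem_sub_simps(4)[OF d, of b b] mem_sub_simps(4)[OF d, of b c] by simp
    then show "b = c" using bc by (rule dvd_diff_less_eq)
  qed
  then show "inj_on (dih_sub p) P" "inj_on (dih_sub n) N"
    using dvds by blast+
qed

lemma rot_sub_neq: "rot_sub 1 \<noteq> rot_sub p"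
  using mem_sub_simps(1)[of 1 1] mem_sub_simps(1)[of p 1] by auto

lemma rot_sub_neq_dih_sub: "d dvd n \<Longrightarrow> e dvd n \<Longrightarrow> rot_sub d \<noteq> dih_sub e b"
  using mem_sub_simps(2)[of d b] mem_sub_simps(4)[of e b b] by auto

lemma finite_big: "finite big" and finite_small: "finite small"
  by (auto simp: big_def small_def)

lemma card_big: "card big = p + 2"
proof -
  have "card big = card {rot_sub 1, rot_sub p} + card (dih_sub p ` P)"
    unfolding big_def using rot_sub_neq_dih_sub by (intro card_Un_disjoint) auto
  then show ?thesis
    using rot_sub_neq by (simp add: card_image inj_dih_sub)
qed

text \<open>The divisors 1, \<open>p\<close> and \<open>n\<close> give all subgroups. Of these
  \<open>rot_sub n\<close> is trivial, \<open>dih_sub 1 0\<close> is the whole group, and the others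
  make up \<open>big\<close> and \<open>small\<close>.\<close>

lemma pverts_eq: "pverts \<Gamma> = big \<union> small"
proof -
  have one: "rot_sub n = {\<one>}"
    by (subst set_eq_iff_exponents)
      (auto simp: mem_sub_simps sub_subset_carrier rot_eq_iff simp flip: rot_0)
  have all: "dih_sub 1 0 = carrier G"
    by (subst set_eq_iff_exponents) (auto simp: mem_sub_simps sub_subset_carrier)
  have "H \<in> pverts \<Gamma> \<longleftrightarrow> H \<in> big \<union> small" for H
  proof -
    have "H \<in> pverts \<Gamma> \<longleftrightarrow> subgroup H G \<and> H \<noteq> {\<one>} \<and> H \<noteq> carrier G"
      by (simp add: intersection_graph_def Let_def)
    also have "subgroup H G \<longleftrightarrow> H \<in> big \<union> small \<or> H = {\<one>} \<or> H = carrier G"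
    proof -
      have "b = 0" if "b \<in> {0..<int 1}" for b using that by auto
      then have "(\<exists>b\<in>{0..<int 1}. H = dih_sub 1 b) \<longleftrightarrow> H = carrier G"
        using all by (metis atLeastLessThan_iff of_nat_1 order_refl zero_less_one)
      moreover have "subgroup H G \<longleftrightarrow>
          H = rot_sub 1 \<or> (\<exists>b\<in>{0..<int 1}. H = dih_sub 1 b) \<or>
          H = rot_sub p \<or> (\<exists>b\<in>P. H = dih_sub p b) \<or> H = rot_sub n \<or> (\<exists>b\<in>N. H = dih_sub n b)"
        unfolding subgroup_iff dvd_n_iff by blast
      ultimately show ?thesis unfolding one big_def small_def by blast
    qed
    also have "\<dots> \<and> H \<noteq> {\<one>} \<and> H \<noteq> carrier G \<longleftrightarrow> H \<in> big \<union> small"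
    proof -
      \<comment> \<open>No listed vertex is an excluded subgroup: the trivial one lacks
        \<open>\<rho> (int p)\<close> and every reflection, members of \<open>big\<close> lack
        \<open>\<sigma> 0\<close> or \<open>\<rho> 1\<close>, and members of \<open>small\<close>
        lack \<open>\<rho> 1\<close>.\<close>
      have "{\<one>} \<notin> big" using rot_p_mem_big[of "{\<one>}"] by (auto simp: rot_eq_iff simp flip: rot_0)
      moreover have "{\<one>} \<notin> small"
        by (auto simp: small_def one[symmetric] rot_sub_neq_dih_sub)
      moreover have "carrier G \<notin> big"
      proof
        assume "carrier G \<in> big"
        then consider d where "d dvd n" "carrier G = rot_sub d" | b where "carrier G = dih_sub p b"
          unfolding big_def using dvd_n_iff by blast
        then show False
        proof cases
          case 1
          then show False using mem_sub_simps(2)[of d 0] ref_closed[of 0] by simp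
        next
          case 2
          then show False using mem_sub_simps(3)[of p 1 b] rot_closed[of 1] by simp
        qed
      qed
      moreover have "carrier G \<notin> small" using rot_mem_small[of "carrier G" 1] by auto
      ultimately show ?thesis by blast
    qed
    finally show ?thesis .
  qed
  then show ?thesis by blast
qed

section \<open>Adjacency\<close>

lemma parcs_iff:
  "(H, K) \<in> parcs \<Gamma> \<longleftrightarrow> H \<in> pverts \<Gamma> \<and> K \<in> pverts \<Gamma> \<and> H \<noteq> K \<and> H \<inter> K \<noteq> {\<one>}"
  by (auto simp: intersection_graph_def Let_def)

lemma subgroup_vertex: "H \<in> pverts \<Gamma> \<Longrightarrow> subgroup H G"
  by (auto simp: intersection_graph_def Let_def)

lemma arc_sym: "(H, K) \<in> parcs \<Gamma> \<Longrightarrow> (K, H) \<in> parcs \<Gamma>"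
  by (auto simp: parcs_iff)

text \<open>The two share \<open>\<rho> (int p)\<close>, which is not the identity because
  \<open>n\<close> does not divide \<open>p\<close>.\<close>

lemma arc_big:
  assumes "H \<in> big" "K \<in> big" "H \<noteq> K"
  shows "(H, K) \<in> parcs \<Gamma>"
proof -
  have "H \<in> pverts \<Gamma>" "K \<in> pverts \<Gamma>" using assms pverts_eq by auto
  moreover from this have "H \<inter> K \<noteq> {\<one>}"
    using assms rot_p_mem_big not_dvds(3) Int_nontrivial_iff[OF subgroup_vertex subgroup_vertex]
    by blast
  ultimately show ?thesis using assms by (simp add: parcs_iff)
qed

lemma dih_sub_p_big: "dih_sub p (j mod int p) \<in> big"
  using p_gt_1 by (auto simp: big_def)

text \<open>The only non-trivial element of \<open>dih_sub n j\<close> is \<open>\<sigma> j\<close>,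
  so its neighbours are the other vertices containing \<open>\<sigma> j\<close>. Rotation subgroups
  contain no reflection, and among the \<open>dih_sub p b\<close> the residue of \<open>j\<close>
  singles out one.\<close>

lemma arc_small_iff:
  assumes j: "j \<in> N"
  shows "(dih_sub n j, K) \<in> parcs \<Gamma> \<longleftrightarrow> K = dih_sub p (j mod int p)"
proof -
  have jV: "dih_sub n j \<in> pverts \<Gamma>" using j by (auto simp: pverts_eq small_def)
  have Int: "dih_sub n j \<inter> K \<noteq> {\<one>} \<longleftrightarrow> \<sigma> j \<in> K" if "K \<in> pverts \<Gamma>"
  proof -
    have "\<sigma> k = \<sigma> j" if "\<sigma> k \<in> dih_sub n j" for k
      using that by (simp add: mem_sub_simps ref_eq_iff)
    moreover have "\<sigma> j \<in> dih_sub n j" "\<And>k. \<rho> k \<in> dih_sub n j \<longleftrightarrow> int n dvd k"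
      by (simp_all add: mem_sub_simps)
    ultimately show ?thesis
      unfolding Int_nontrivial_iff[OF subgroup_vertex[OF jV] subgroup_vertex[OF that]]
      by (metis IntD1 IntD2 IntI)
  qed
  have j': "j mod int p \<in> P" using p_gt_1 by simp
  have pj: "int p dvd j - b \<longleftrightarrow> b = j mod int p" if "b \<in> P" for b
    using that by (auto simp flip: mod_eq_dvd_iff)
  have nj: "int n dvd j - b \<longleftrightarrow> b = j" if "b \<in> N" for b
    using dvd_diff_less_eq[of "int n" j b] that j by auto
  have "K \<in> pverts \<Gamma> \<and> \<sigma> j \<in> K \<longleftrightarrow> K = dih_sub p (j mod int p) \<or> K = dih_sub n j"
  proof
    assume *: "K \<in> pverts \<Gamma> \<and> \<sigma> j \<in> K"
    then consider "K = rot_sub 1" | "K = rot_sub p" | b where "b \<in> P" "K = dih_sub p b"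
      | b where "b \<in> N" "K = dih_sub n b"
      unfolding pverts_eq big_def small_def by blast
    then show "K = dih_sub p (j mod int p) \<or> K = dih_sub n j"
      using * by cases (auto simp: mem_sub_simps pj nj)
  next
    have "dih_sub p (j mod int p) \<in> pverts \<Gamma>"
      using dih_sub_p_big pverts_eq by blast
    moreover have "\<sigma> j \<in> dih_sub p (j mod int p)" "\<sigma> j \<in> dih_sub n j"
      using pj[OF j'] by (simp_all add: mem_sub_simps)
    ultimately show "K = dih_sub p (j mod int p) \<or> K = dih_sub n j \<Longrightarrow>
        K \<in> pverts \<Gamma> \<and> \<sigma> j \<in> K"
      using jV by blast
  qed
  moreover have "dih_sub p (j mod int p) \<noteq> dih_sub n j"
    using mem_sub_simps(3)[of p "int p"] mem_sub_simps(3)[of n "int p"] by auto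
  ultimately show ?thesis unfolding parcs_iff using Int jV by metis
qed

lemma small_arc_iff:
  assumes "j \<in> N"
  shows "(K, dih_sub n j) \<in> parcs \<Gamma> \<longleftrightarrow> K = dih_sub p (j mod int p)"
  using arc_small_iff[OF assms] arc_sym by blast

lemma arc_big_iff:
  assumes H: "H \<in> big"
  shows "(H, K) \<in> parcs \<Gamma> \<longleftrightarrow>
    K \<in> big - {H} \<or> (\<exists>j\<in>N. K = dih_sub n j \<and> H = dih_sub p (j mod int p))"
proof
  assume HK: "(H, K) \<in> parcs \<Gamma>"
  then have "K \<noteq> H" "K \<in> pverts \<Gamma>" unfolding parcs_iff by blast+
  then consider "K \<in> big - {H}" | j where "j \<in> N" "K = dih_sub n j"
    unfolding pverts_eq small_def by blast
  then show "K \<in> big - {H} \<or> (\<exists>j\<in>N. K = dih_sub n j \<and> H = dih_sub p (j mod int p))"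
    using HK small_arc_iff by cases blast+
next
  show "K \<in> big - {H} \<or> (\<exists>j\<in>N. K = dih_sub n j \<and> H = dih_sub p (j mod int p)) \<Longrightarrow>
      (H, K) \<in> parcs \<Gamma>"
    using arc_big[OF H] small_arc_iff by blast
qed

section \<open>Degrees\<close>

lemma Image_rot_sub:
  assumes "d \<in> {1, p}"
  shows "parcs \<Gamma> `` {rot_sub d} = big - {rot_sub d}"
proof -
  have "rot_sub d \<in> big" using assms by (auto simp: big_def)
  moreover have "d dvd n" using assms by auto
  ultimately show ?thesis
    using arc_big_iff rot_sub_neq_dih_sub[OF _ dvds(2)] by blast
qed

lemma Image_dih_sub_p:
  assumes b: "b \<in> P"
  shows "parcs \<Gamma> `` {dih_sub p b} = (big - {dih_sub p b}) \<union> dih_sub n ` {j \<in> N. j mod int p = b}"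
proof -
  have "dih_sub p b \<in> big" using b by (auto simp: big_def)
  moreover have "dih_sub p b = dih_sub p (j mod int p) \<longleftrightarrow> j mod int p = b" for j
    using inj_on_eq_iff[OF inj_dih_sub(1) b, of "j mod int p"] p_gt_1 by auto
  ultimately show ?thesis
    using arc_big_iff by blast
qed

text \<open>Division by \<open>p\<close> writes such a \<open>j\<close> as
  \<open>b + int p * i\<close>, and the range of \<open>j\<close> leaves exactly \<open>p\<close>
  quotients \<open>i\<close>.\<close>

lemma card_residue_class:
  assumes "b \<in> P"
  shows "card {j \<in> N. j mod int p = b} = p"
proof -
  have "{j \<in> N. j mod int p = b} = (\<lambda>i. b + int p * i) ` P"
  proof (intro equalityI subsetI)
    fix j assume j: "j \<in> {j \<in> N. j mod int p = b}"
    then have "j = b + int p * (j div int p)" by auto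
    moreover have "j div int p \<in> P"
    proof -
      have "int p * (j div int p) + j mod int p = j" by simp
      moreover have "j < int p * int p" using j by (simp add: n_eq power2_eq_square)
      moreover have "0 \<le> j mod int p" using p_gt_1 by simp
      ultimately have "int p * (j div int p) < int p * int p" by linarith
      then have "j div int p < int p" using p_gt_1 by simp
      then show ?thesis using j p_gt_1 by (simp add: pos_imp_zdiv_nonneg_iff)
    qed
    ultimately show "j \<in> (\<lambda>i. b + int p * i) ` P" by (rule image_eqI)
  next
    fix j assume "j \<in> (\<lambda>i. b + int p * i) ` P"
    then obtain i where i: "i \<in> P" "j = b + int p * i" by blast
    \<comment> \<open>The bound \<open>p ^ 2 - p\<close> leaves room for the residue
      \<open>b < p\<close>.\<close>
    then have "int p * i \<le> int p * (int p - 1)" by (intro mult_left_mono) auto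
    then have "j < int n" using i assms by (simp add: n_eq power2_eq_square algebra_simps)
    then show "j \<in> {j \<in> N. j mod int p = b}" using i assms by simp
  qed
  moreover have "inj_on (\<lambda>i. b + int p * i) P" using p_gt_1 by (auto simp: inj_on_def)
  ultimately show ?thesis by (simp add: card_image)
qed

text \<open>A member of the clique \<open>big\<close> has \<open>p + 1\<close> neighbours inside it;
  \<open>dih_sub p b\<close> also has \<open>p\<close> leaves, one for each index in the residue
  class of \<open>b\<close>.\<close>

lemma degrees:
  shows "d \<in> {1, p} \<Longrightarrow> out_degree \<Gamma> (rot_sub d) = p + 1"
    and "b \<in> P \<Longrightarrow> out_degree \<Gamma> (dih_sub p b) = 2 * p + 1"
    and "j \<in> N \<Longrightarrow> out_degree \<Gamma> (dih_sub n j) = 1"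
proof -
  assume "d \<in> {1, p}"
  moreover from this have "rot_sub d \<in> big" by (auto simp: big_def)
  ultimately show "out_degree \<Gamma> (rot_sub d) = p + 1"
    by (simp add: out_degree_eq_card Image_rot_sub card_big finite_big)
next
  assume b: "b \<in> P"
  let ?S = "dih_sub n ` {j \<in> N. j mod int p = b}"
  have "dih_sub p b \<in> big" using b by (auto simp: big_def)
  then have "card (big - {dih_sub p b}) = p + 1" by (simp add: card_big finite_big)
  moreover have "card ?S = p"
    using card_residue_class[OF b] by (subst card_image[OF inj_on_subset[OF inj_dih_sub(2)]]) auto
  moreover have "card (big - {dih_sub p b} \<union> ?S) = card (big - {dih_sub p b}) + card ?S"
  proof (rule card_Un_disjoint)
    have "?S \<subseteq> small" by (auto simp: small_def)
    then show "finite ?S" "(big - {dih_sub p b}) \<inter> ?S = {}"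
      using finite_small big_Int_small finite_subset by blast+
  qed (simp add: finite_big)
  ultimately show "out_degree \<Gamma> (dih_sub p b) = 2 * p + 1"
    by (simp add: out_degree_eq_card Image_dih_sub_p[OF b])
next
  assume "j \<in> N"
  then have "parcs \<Gamma> `` {dih_sub n j} = {dih_sub p (j mod int p)}"
    using arc_small_iff by auto
  then show "out_degree \<Gamma> (dih_sub n j) = 1" by (simp add: out_degree_eq_card)
qed

section \<open>Distances and eccentricities\<close>

text \<open>The leaf is entered through its sole neighbour \<open>dih_sub p (j mod int p)\<close>,
  which is either \<open>H\<close> or adjacent to \<open>H\<close> in the clique.\<close>

lemma relpow_big_small:
  assumes "H \<in> big" "j \<in> N"
  shows "\<exists>m\<le>2. (H, dih_sub n j) \<in> parcs \<Gamma> ^^ m"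
proof (cases "H = dih_sub p (j mod int p)")
  case True
  then have "(H, dih_sub n j) \<in> parcs \<Gamma> ^^ 1" using assms small_arc_iff by simp
  then show ?thesis by (intro exI[of _ 1]) simp
next
  case False
  then have "(H, dih_sub p (j mod int p)) \<in> parcs \<Gamma>" using assms arc_big dih_sub_p_big by blast
  then have "(H, dih_sub n j) \<in> parcs \<Gamma> ^^ 2"
    using assms small_arc_iff by (auto simp: numeral_2_eq_2)
  then show ?thesis by blast
qed

lemma relpow_big_big:
  assumes "H \<in> big" "K \<in> big"
  shows "\<exists>m\<le>1. (H, K) \<in> parcs \<Gamma> ^^ m"
proof (cases "H = K")
  case False
  then show ?thesis using arc_big[OF assms] by (intro exI[of _ 1]) simp
qed (auto intro: exI[of _ 0])

lemma relpow_big: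
  assumes "H \<in> big" "K \<in> pverts \<Gamma>"
  shows "\<exists>m\<le>2. (H, K) \<in> parcs \<Gamma> ^^ m"
proof -
  consider "K \<in> big" | j where "j \<in> N" "K = dih_sub n j"
    using assms unfolding pverts_eq small_def by blast
  then show ?thesis
  proof cases
    case 1
    then show ?thesis using relpow_big_big[OF assms(1)] by (meson one_le_numeral order_trans)
  next
    case 2
    then show ?thesis using relpow_big_small[OF assms(1)] by simp
  qed
qed

text \<open>The leaves with indices 0 and 1 hang on different vertices. For any given vertex one of
  them is attached elsewhere, and it serves as the far vertex for the eccentricities.\<close>

lemma residue_01: "0 \<in> N" "1 \<in> N" "(0::int) mod int p = 0" "(1::int) mod int p = 1"
  using p_gt_1 n_gt_p by auto

text \<open>Two arcs reach everything, and a leaf hanging on another vertex is neither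
  \<open>H\<close> nor adjacent to it.\<close>

lemma ecc_big:
  assumes H: "H \<in> big"
  shows "ecc \<Gamma> H = 2"
proof -
  have "dih_sub p 0 \<noteq> dih_sub p 1"
    using inj_on_eq_iff[OF inj_dih_sub(1), of 0 1] p_gt_1 by simp
  then obtain j where j: "j \<in> N" "H \<noteq> dih_sub p (j mod int p)"
    using residue_01 by metis
  have "ecc \<Gamma> H = ereal (real 2)"
  proof (rule ecc_eqI)
    show "H \<in> pverts \<Gamma>" "dih_sub n j \<in> pverts \<Gamma>"
      using H j by (auto simp: pverts_eq small_def)
    show "\<exists>m\<le>2. (H, K) \<in> parcs \<Gamma> ^^ m" if "K \<in> pverts \<Gamma>" for K
      using H that by (rule relpow_big)
    show "(H, dih_sub n j) \<notin> parcs \<Gamma> ^^ m" if "m < 2" for m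
    proof -
      have "H \<noteq> dih_sub n j" using H j big_Int_small by (auto simp: small_def)
      moreover have "(H, dih_sub n j) \<notin> parcs \<Gamma>" using j small_arc_iff by blast
      ultimately show ?thesis using that by (auto simp: less_Suc_eq numeral_2_eq_2)
    qed
  qed
  then show ?thesis by simp
qed

text \<open>A leaf can only step to its neighbour in \<open>big\<close>, from which two more arcs
  reach everything. A leaf attached to a different vertex needs all three.\<close>

lemma ecc_small:
  assumes j: "j \<in> N"
  shows "ecc \<Gamma> (dih_sub n j) = 3"
proof -
  let ?H = "dih_sub n j" and ?D = "dih_sub p (j mod int p)"
  have arc: "(?H, ?D) \<in> parcs \<Gamma>" using arc_small_iff[OF j] by blast
  have "dih_sub p 0 \<noteq> dih_sub p 1"
    using inj_on_eq_iff[OF inj_dih_sub(1), of 0 1] p_gt_1 by simp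
  then obtain i where i: "i \<in> N" "?D \<noteq> dih_sub p (i mod int p)"
    using residue_01 by metis
  have "ecc \<Gamma> ?H = ereal (real 3)"
  proof (rule ecc_eqI)
    show "?H \<in> pverts \<Gamma>" "dih_sub n i \<in> pverts \<Gamma>"
      using i j by (auto simp: pverts_eq small_def)
    show "\<exists>m\<le>3. (?H, K) \<in> parcs \<Gamma> ^^ m" if "K \<in> pverts \<Gamma>" for K
    proof -
      obtain m where "m \<le> 2" "(?D, K) \<in> parcs \<Gamma> ^^ m"
        using relpow_big[OF dih_sub_p_big \<open>K \<in> pverts \<Gamma>\<close>] by blast
      then show ?thesis using relpow_Suc_I2[OF arc] by (intro exI[of _ "Suc m"]) auto
    qed
    show "(?H, dih_sub n i) \<notin> parcs \<Gamma> ^^ m" if "m < 3" for m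
    proof -
      have "?H \<noteq> dih_sub n i" using i j arc_small_iff by metis
      then have "(?H, dih_sub n i) \<notin> parcs \<Gamma> ^^ 0" by simp
      moreover have "dih_sub n i \<noteq> ?D"
        using i(1) dih_sub_p_big big_Int_small small_def by (metis disjoint_iff imageI)
      then have "(?H, dih_sub n i) \<notin> parcs \<Gamma> ^^ 1"
        unfolding relpow_1 using arc_small_iff[OF j] by blast
      \<comment> \<open>The middle vertex of a walk with two arcs would be the neighbour of both
        leaves, but these hang on different vertices.\<close>
      moreover have "(?H, dih_sub n i) \<notin> parcs \<Gamma> O parcs \<Gamma>"
      proof
        assume "(?H, dih_sub n i) \<in> parcs \<Gamma> O parcs \<Gamma>"
        then obtain L where "(?H, L) \<in> parcs \<Gamma>" "(L, dih_sub n i) \<in> parcs \<Gamma>" by blast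
        then have "L = ?D" "L = dih_sub p (i mod int p)"
          using arc_small_iff[OF j] small_arc_iff[OF i(1)] by simp_all
        with i(2) show False by simp
      qed
      then have "(?H, dih_sub n i) \<notin> parcs \<Gamma> ^^ 2" by (simp add: numeral_2_eq_2)
      moreover have "m = 0 \<or> m = 1 \<or> m = 2" using that by linarith
      ultimately show ?thesis by blast
    qed
  qed
  then show ?thesis by simp
qed

section \<open>Summation over the vertices\<close>

text \<open>The rotation subgroups contribute \<open>2 * (2 * p + 2)\<close>, the
  \<open>dih_sub p b\<close> together \<open>p * (4 * p + 2)\<close>, and the leaves
  \<open>3 * p ^ 2\<close>.\<close>

lemma eccentric_connectivity_index_eq:
  "eccentric_connectivity_index \<Gamma> = ereal (real (7 * p ^ 2 + 6 * p + 4))"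
proof -
  let ?t = "\<lambda>v. ereal (real (out_degree \<Gamma> v)) * ecc \<Gamma> v"
  have rot: "?t (rot_sub d) = ereal (2 * p + 2)" if "d \<in> {1, p}" for d
  proof -
    have "rot_sub d \<in> big" using that by (auto simp: big_def)
    then show ?thesis by (simp add: ecc_big degrees(1)[OF that])
  qed
  have dih: "?t (dih_sub p b) = ereal (4 * p + 2)" if "b \<in> P" for b
  proof -
    have "dih_sub p b \<in> big" using that by (auto simp: big_def)
    then show ?thesis by (simp add: ecc_big degrees(2)[OF that])
  qed
  have ref: "?t (dih_sub n j) = ereal 3" if "j \<in> N" for j
    by (simp add: ecc_small[OF that] degrees(3)[OF that])
  have "eccentric_connectivity_index \<Gamma> = sum ?t big + sum ?t small"
    unfolding eccentric_connectivity_index_def pverts_eq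
    by (rule sum.union_disjoint) (auto simp: finite_big finite_small big_Int_small)
  also have "sum ?t big = sum ?t {rot_sub 1, rot_sub p} + sum ?t (dih_sub p ` P)"
    unfolding big_def using rot_sub_neq_dih_sub by (intro sum.union_disjoint) auto
  also have "sum ?t {rot_sub 1, rot_sub p} = ereal (2 * (2 * p + 2))"
    using rot_sub_neq rot[of 1] rot[of p] by simp
  also have "sum ?t (dih_sub p ` P) = ereal (p * (4 * p + 2))"
    using dih by (simp add: sum.reindex inj_dih_sub distrib_left)
  also have "sum ?t small = ereal (n * 3)"
    unfolding small_def using ref by (simp add: sum.reindex inj_dih_sub)
  finally show ?thesis by (simp add: n_eq power2_eq_square algebra_simps)
qed

end

theorem theorem3p7:
  fixes p n :: nat
  assumes "prime p" and "n = p ^ 2"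
  shows "eccentric_connectivity_index (intersection_graph (dihedral_group n))
    = ereal (real (7 * p ^ 2 + 6 * p + 4))"
proof -
  have "n > 0" using assms prime_gt_0_nat by simp
  then obtain \<rho> \<sigma> where "dihedral (dihedral_group n) n \<rho> \<sigma>"
    by (rule dihedral_dihedral_group)
  then interpret dihedral_prime_square "dihedral_group n" n \<rho> \<sigma> p
    using assms by (intro dihedral_prime_square.intro dihedral_prime_square_axioms.intro)
  show ?thesis by (rule eccentric_connectivity_index_eq)
qed

end
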